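(* Let $m\in\mathbb{N}^+$ and let $$f=\sum_{i,j=1}^{m} a_{ij}\, x_i x_j,\qquad g=\sum_{i,j=1}^{m} b_{ij}\, x_i x_j$$ be homogeneous quadratic symmetric noncommutative polynomials, where $a_{ij}, b_{ij}\in\mathbb{R}$ and $a_{ij}=a_{ji}$, $b_{ij}=b_{ji}$ for all $i,j$. Suppose that there is an $\hat{X}\in(\mathbb{SR}^{\hat n})^m$ for some $\hat n\in\mathbb{N}^+$ such that $g(\hat X)\succ 0$. Then the following three statements are equivalent: (1) For all $X\in\mathbb{R}^m$, if $g(X)\ge 0$, then $f(X)\ge 0$. (2) For all $n\in\mathbb{N}^+$ and all $X\in(\mathbb{SR}^n)^m$, if $g(X)\succeq 0$, then $f(X)\succeq 0$. (3) There is a nonnegative real number $\lambda$ such that $f(X)-\lambda g(X)\succeq 0$ for all $n\in\mathbb{N}^+$ and all $X\in(\mathbb{SR}^n)^m$.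
   Context: $\mathbb{N}^+$ is the set of positive integers. $\mathbb{SR}^n$ is the set of real symmetric $n\times n$ matrices, and $(\mathbb{SR}^n)^m$ is the set of $m$-tuples $X=(X_1,\dots,X_m)$ of such matrices. The variables $x_1,\dots,x_m$ are noncommuting symmetric variables (so $(x_ix_j)^T=x_jx_i$). The evaluation of $f$ at $X\in(\mathbb{SR}^n)^m$ is $f(X)=\sum_{i,j=1}^m a_{ij}X_iX_j\in\mathbb{SR}^n$ (matrix products), and similarly for $g$; for $X\in\mathbb{R}^m$ (the case $n=1$) the values are real numbers. $M\succeq 0$ (resp. $M\succ 0$) means that the real symmetric matrix $M$ is positive semidefinite (resp. positive definite). *)

theory Defs
  imports Complex_Main "Jordan_Normal_Form.Matrix"
begin

definition sym_mats :: "nat \<Rightarrow> real mat set" where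
  "sym_mats n = {M \<in> carrier_mat n n. transpose_mat M = M}"

definition pos_semidef :: "real mat \<Rightarrow> bool" where
  "pos_semidef M \<longleftrightarrow> M \<in> sym_mats (dim_row M) \<and>
     (\<forall>v \<in> carrier_vec (dim_row M). 0 \<le> v \<bullet> (M *\<^sub>v v))"

definition pos_def :: "real mat \<Rightarrow> bool" where
  "pos_def M \<longleftrightarrow> M \<in> sym_mats (dim_row M) \<and>
     (\<forall>v \<in> carrier_vec (dim_row M). v \<noteq> 0\<^sub>v (dim_row M) \<longrightarrow> 0 < v \<bullet> (M *\<^sub>v v))"

text \<open>The homogeneous quadratic noncommutative polynomial with coefficients \<open>a i j\<close>
  in the variables with indices \<open>0, \<dots>, m - 1\<close> is represented by \<open>m\<close> and \<open>a\<close>. An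
  \<open>m\<close>-tuple is a function on \<open>nat\<close> whose values at indices \<open>\<ge> m\<close> are irrelevant.\<close>

definition sym_tuples :: "nat \<Rightarrow> nat \<Rightarrow> (nat \<Rightarrow> real mat) set" where
  "sym_tuples m n = {..<m} \<rightarrow> sym_mats n"

text \<open>The dimension \<open>n\<close> is an explicit argument because the zero matrix, hence a sum of
  matrices, depends on it.\<close>

definition quad_eval ::
  "nat \<Rightarrow> (nat \<Rightarrow> nat \<Rightarrow> real) \<Rightarrow> nat \<Rightarrow> (nat \<Rightarrow> real mat) \<Rightarrow> real mat" where
  "quad_eval m a n X =
     finsum (ring_mat TYPE(real) n ())
       (\<lambda>(i, j). a i j \<cdot>\<^sub>m (X i * X j)) ({..<m} \<times> {..<m})"

definition quad_eval_real ::
  "nat \<Rightarrow> (nat \<Rightarrow> nat \<Rightarrow> real) \<Rightarrow> (nat \<Rightarrow> real) \<Rightarrow> real" where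
  "quad_eval_real m a x = (\<Sum>i<m. \<Sum>j<m. a i j * (x i * x j))"

lemma finsum_ring_mat:
  fixes F :: "'b \<Rightarrow> real mat"
  assumes "finite S" and "\<And>s. s \<in> S \<Longrightarrow> F s \<in> carrier_mat n n"
  shows "finsum (ring_mat TYPE(real) n ()) F S = mat n n (\<lambda>rc. \<Sum>s\<in>S. F s $$ rc)"
  using assms
proof (induction S rule: finite_induct)
  case empty
  interpret ring "ring_mat TYPE(real) n ()" by (rule ring_mat)
  show ?case by (auto simp: ring_mat_simps)
next
  case (insert s S)
  interpret ring "ring_mat TYPE(real) n ()" by (rule ring_mat)
  have "finsum (ring_mat TYPE(real) n ()) F (insert s S) =
      F s + finsum (ring_mat TYPE(real) n ()) F S"
    using insert by (subst finsum_insert) (auto simp: ring_mat_simps)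
  then show ?case using insert by (auto intro!: eq_matI)
qed

lemma quad_eval_entries:
  assumes "X \<in> sym_tuples m n"
  shows "quad_eval m a n X =
    mat n n (\<lambda>rc. \<Sum>i<m. \<Sum>j<m. a i j * (X i * X j) $$ rc)"
proof -
  have X: "X i \<in> carrier_mat n n" if "i < m" for i
    using assms that by (auto simp: sym_tuples_def sym_mats_def)
  have "quad_eval m a n X = mat n n (\<lambda>rc. \<Sum>s\<in>{..<m} \<times> {..<m}.
      (case s of (i, j) \<Rightarrow> a i j \<cdot>\<^sub>m (X i * X j)) $$ rc)"
    unfolding quad_eval_def by (rule finsum_ring_mat) (auto intro!: smult_carrier_mat mult_carrier_mat X)
  also have "\<dots> = mat n n (\<lambda>rc. \<Sum>i<m. \<Sum>j<m. a i j * (X i * X j) $$ rc)"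
  proof (rule eq_matI, goal_cases)
    case (1 r c)
    have "(a i j \<cdot>\<^sub>m (X i * X j)) $$ (r, c) = a i j * (X i * X j) $$ (r, c)"
      if "i < m" "j < m" for i j
      using X[OF that(1)] X[OF that(2)] 1 by (intro index_smult_mat(1)) auto
    then show ?case using 1 by (simp add: sum.cartesian_product cong: sum.cong)
      (intro sum.cong, auto)
  qed auto
  finally show ?thesis .
qed

text \<open>For \<open>n = 1\<close> the two evaluations agree under the identification of reals with
  \<open>1 \<times> 1\<close> matrices.\<close>

lemma quad_eval_dim_one:
  "quad_eval m a 1 (\<lambda>i. mat 1 1 (\<lambda>_. x i)) = mat 1 1 (\<lambda>_. quad_eval_real m a x)"
proof -
  have "(\<lambda>i. mat 1 1 (\<lambda>_. x i)) \<in> sym_tuples m 1"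
    by (auto simp: sym_tuples_def sym_mats_def intro!: eq_matI)
  from quad_eval_entries[OF this, of a] show ?thesis
    by (auto simp: quad_eval_real_def scalar_prod_def intro!: eq_matI)
qed

end

(* Evaluating v^T f(X) v splits f(X) into a sum of values of the commutative form f at the
   points (X_i v)_k, one for each coordinate k. Hence positivity of f - l g on matrix tuples
   is the same as positivity on real points, and g(X) > 0 for some X gives g(x) > 0 for some
   real x. What remains is the homogeneous S-lemma: if g(x) < 0 < g(y), the form g vanishes
   at two points x + t y with t of opposite signs, where f is nonnegative; combining both
   inequalities gives f(x)/g(x) <= f(y)/g(y), and l is the infimum of the right-hand side. *)
theory Submission
  imports Defs
begin

section \<open>The commutative S-lemma for real quadratic forms\<close>

lemma quad_eval_real_add:
  "\<exists>L. \<forall>t. quad_eval_real m a (\<lambda>i. x i + t * y i) =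
     quad_eval_real m a x + t * L + t\<^sup>2 * quad_eval_real m a y"
  \<comment> \<open>The coefficient of \<open>t\<close> collects both mixed terms. Later only its
    independence of \<open>t\<close> matters, because it cancels.\<close>
  by (rule exI[of _ "\<Sum>i<m. \<Sum>j<m. a i j * (x i * y j + y i * x j)"])
    (simp add: quad_eval_real_def sum_distrib_left flip: sum.distrib,
      simp add: algebra_simps power2_eq_square)

text \<open>Since \<open>p * r < 0\<close>, the square root of the discriminant exceeds the absolute
  value of \<open>q\<close>, so 0 lies strictly between the roots. The last equation is Vieta's
  formula for their product.\<close>

lemma quadratic_roots_opposite_signs:
  fixes p q r :: real
  assumes "p < 0" "0 < r"
  obtains s t where "s < 0" "0 < t" "p + s * q + s\<^sup>2 * r = 0" "p + t * q + t\<^sup>2 * r = 0"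
    "p = s * t * r"
proof -
  define D where "D = sqrt (q\<^sup>2 - 4 * (p * r))"
  have pr: "p * r < 0" using assms by (simp add: mult_neg_pos)
  then have "0 \<le> q\<^sup>2 - 4 * (p * r)" using zero_le_power2[of q] by linarith
  then have D2: "D\<^sup>2 = q\<^sup>2 - 4 * (p * r)" unfolding D_def by simp
  have D: "\<bar>q\<bar> < D" unfolding D_def
    using pr by (intro real_less_rsqrt) simp
  define s where "s = (- q - D) / (2 * r)"
  define t where "t = (- q + D) / (2 * r)"
  have "s < 0" "0 < t" using D assms by (auto simp: s_def t_def divide_less_0_iff)
  \<comment> \<open>Eliminating \<open>p\<close> in favour of \<open>D\<close> turns the three
    claims into rational identities in \<open>q\<close>, \<open>D\<close> and
    \<open>r\<close>.\<close>
  have p: "p = (q\<^sup>2 - D\<^sup>2) / (4 * r)" using D2 assms by (simp add: field_simps)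
  have "p + s * q + s\<^sup>2 * r = 0" "p + t * q + t\<^sup>2 * r = 0" "p = s * t * r"
    using assms unfolding p s_def t_def
    by (simp_all add: field_simps power2_eq_square)
  with \<open>s < 0\<close> \<open>0 < t\<close> show thesis by (rule that)
qed

lemma quad_eval_real_cross_le:
  assumes nonneg: "\<And>x. 0 \<le> quad_eval_real m b x \<Longrightarrow> 0 \<le> quad_eval_real m a x"
    and x: "quad_eval_real m b x < 0" and y: "0 < quad_eval_real m b y"
  shows "quad_eval_real m b x * quad_eval_real m a y \<le> quad_eval_real m a x * quad_eval_real m b y"
proof -
  let ?f = "quad_eval_real m a" and ?g = "quad_eval_real m b"
  obtain K where K: "\<And>t. ?f (\<lambda>i. x i + t * y i) = ?f x + t * K + t\<^sup>2 * ?f y"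
    using quad_eval_real_add[of m a x y] by blast
  obtain L where L: "\<And>t. ?g (\<lambda>i. x i + t * y i) = ?g x + t * L + t\<^sup>2 * ?g y"
    using quad_eval_real_add[of m b x y] by blast
  obtain s t where st: "s < 0" "0 < t" "?g x + s * L + s\<^sup>2 * ?g y = 0"
    "?g x + t * L + t\<^sup>2 * ?g y = 0" and prod: "?g x = s * t * ?g y"
    using quadratic_roots_opposite_signs[OF x y] by metis
  have fs: "0 \<le> ?f x + s * K + s\<^sup>2 * ?f y" and ft: "0 \<le> ?f x + t * K + t\<^sup>2 * ?f y"
    using nonneg[of "\<lambda>i. x i + s * y i"] nonneg[of "\<lambda>i. x i + t * y i"] st K L by simp_all
  \<comment> \<open>The positive weights \<open>t\<close> and \<open>- s\<close> are chosen so that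
    the terms in \<open>K\<close> cancel. Vieta's formula \<open>prod\<close> then trades
    \<open>s * t * ?g y\<close> for \<open>?g x\<close>.\<close>
  have "0 \<le> t * (?f x + s * K + s\<^sup>2 * ?f y) + (- s) * (?f x + t * K + t\<^sup>2 * ?f y)"
    using st(1,2) by (intro add_nonneg_nonneg mult_nonneg_nonneg fs ft) simp_all
  also have "\<dots> = (t - s) * (?f x - s * t * ?f y)"
    by (simp add: algebra_simps power2_eq_square)
  finally have "s * t * ?f y \<le> ?f x" using st by (simp add: zero_le_mult_iff)
  then have "s * t * ?f y * ?g y \<le> ?f x * ?g y" using y by (intro mult_right_mono) auto
  then show ?thesis by (simp add: prod mult_ac)
qed

lemma homogeneous_S_lemma:
  assumes nonneg: "\<And>x. 0 \<le> quad_eval_real m b x \<Longrightarrow> 0 \<le> quad_eval_real m a x"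
    and x0: "0 < quad_eval_real m b x0"
  obtains l where "0 \<le> l" "\<And>x. l * quad_eval_real m b x \<le> quad_eval_real m a x"
proof -
  let ?f = "quad_eval_real m a" and ?g = "quad_eval_real m b"
  \<comment> \<open>For \<open>?g x > 0\<close> the claim says that \<open>l\<close> is at most the
    quotient at \<open>x\<close>; for \<open>?g x < 0\<close> it says that \<open>l\<close> is at
    least that quotient. The largest \<open>l\<close> allowed by the first kind is the infimum of
    \<open>S\<close>, and the cross inequality makes each quotient of the second kind a lower bound
    of \<open>S\<close>.\<close>
  define S where "S = (\<lambda>y. ?f y / ?g y) ` {y. 0 < ?g y}"
  define l where "l = Inf S"
  have ne: "S \<noteq> {}" using x0 by (auto simp: S_def)
  have S0: "0 \<le> z" if "z \<in> S" for z using that nonneg by (auto simp: S_def)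
  have "l * ?g x \<le> ?f x" for x
  proof (cases "?g x" "0 :: real" rule: linorder_cases)
    case less
    have "?f x / ?g x \<le> z" if "z \<in> S" for z
      using that quad_eval_real_cross_le[OF nonneg less] less
      by (auto simp: S_def field_simps)
    then have "?f x / ?g x \<le> l" unfolding l_def using ne by (intro cInf_greatest)
    then show ?thesis using less by (simp add: field_simps)
  next
    case equal
    then show ?thesis using nonneg[of x] by simp
  next
    case greater
    then have "l \<le> ?f x / ?g x" unfolding l_def
      by (intro cInf_lower bdd_belowI[of _ 0]) (auto simp: S_def intro: S0)
    then show ?thesis using greater by (simp add: field_simps)
  qed
  moreover have "0 \<le> l" unfolding l_def using ne S0 by (intro cInf_greatest)
  ultimately show thesis using that by blast
qed

section \<open>Matrix evaluations: symmetry and reduction to real points\<close>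

lemma quad_eval_carrier [simp]:
  "X \<in> sym_tuples m n \<Longrightarrow> quad_eval m a n X \<in> carrier_mat n n"
  by (simp add: quad_eval_entries)

lemma sym_tuplesD:
  assumes "X \<in> sym_tuples m n" "i < m"
  shows "X i \<in> carrier_mat n n" "transpose_mat (X i) = X i"
  using assms by (auto simp: sym_tuples_def sym_mats_def)

text \<open>Transposition reverses each product of two symmetric matrices; exchanging the summation
  indices undoes this because the coefficients are symmetric.\<close>

lemma quad_eval_sym_mats:
  assumes X: "X \<in> sym_tuples m n" and sym: "\<forall>i<m. \<forall>j<m. a i j = a j i"
  shows "quad_eval m a n X \<in> sym_mats n"
proof -
  have swap: "(X i * X j) $$ (r, c) = (X j * X i) $$ (c, r)"
    if "i < m" "j < m" "r < n" "c < n" for i j r c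
  proof -
    note ij = sym_tuplesD[OF X that(1)] sym_tuplesD[OF X that(2)]
    have "X i * X j = transpose_mat (X j * X i)"
      using ij transpose_mult[of "X j" n n "X i" n] by simp
    also have "\<dots> $$ (r, c) = (X j * X i) $$ (c, r)"
      by (rule index_transpose_mat(1)) (use ij that in auto)
    finally show ?thesis .
  qed
  have "(\<Sum>i<m. \<Sum>j<m. a i j * (X i * X j) $$ (c, r)) =
      (\<Sum>i<m. \<Sum>j<m. a i j * (X i * X j) $$ (r, c))" if "r < n" "c < n" for r c
    by (subst sum.swap) (use sym that in \<open>auto intro!: sum.cong simp: swap[of _ _ c r]\<close>)
  then show ?thesis
    by (auto simp: sym_mats_def quad_eval_entries[OF X] intro!: eq_matI)
qed

lemma scalar_prod_mult_mat_vec: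
  assumes "M \<in> carrier_mat n n" "v \<in> carrier_vec n"
  shows "v \<bullet> (M *\<^sub>v v) = (\<Sum>r<n. \<Sum>c<n. v $ r * (M $$ (r, c) * v $ c))"
  using assms by (simp add: scalar_prod_def sum_distrib_left lessThan_atLeast0)

text \<open>Symmetry of \<open>X i\<close> moves it to the left factor of the scalar product, so
  each monomial contributes the product of the vectors \<open>X i *\<^sub>v v\<close> and
  \<open>X j *\<^sub>v v\<close>. Expanding this in coordinates separates the real points.\<close>

lemma quad_eval_scalar_prod:
  assumes X: "X \<in> sym_tuples m n" and v: "v \<in> carrier_vec n"
  shows "v \<bullet> (quad_eval m a n X *\<^sub>v v) = (\<Sum>k<n. quad_eval_real m a (\<lambda>i. (X i *\<^sub>v v) $ k))"
proof -
  let ?P = "{..<m} \<times> {..<m}"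
  have eval: "quad_eval_real m a x = (\<Sum>(i, j)\<in>?P. a i j * (x i * x j))" for x
    by (simp add: quad_eval_real_def sum.cartesian_product)
  have bilinear: "(\<Sum>r<n. \<Sum>c<n. v $ r * ((X i * X j) $$ (r, c) * v $ c)) =
      (\<Sum>k<n. (X i *\<^sub>v v) $ k * (X j *\<^sub>v v) $ k)" if "i < m" "j < m" for i j
  proof -
    note ij = sym_tuplesD[OF X that(1)] sym_tuplesD[OF X that(2)]
    have "(\<Sum>r<n. \<Sum>c<n. v $ r * ((X i * X j) $$ (r, c) * v $ c)) = v \<bullet> (X i * X j *\<^sub>v v)"
      by (rule scalar_prod_mult_mat_vec[symmetric]) (use ij v in auto)
    also have "\<dots> = v \<bullet> (X i *\<^sub>v (X j *\<^sub>v v))"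
      using ij v by simp
    also have "\<dots> = (transpose_mat (X i) *\<^sub>v v) \<bullet> (X j *\<^sub>v v)"
      by (rule transpose_vec_mult_scalar[symmetric]) (use ij v in auto)
    also have "\<dots> = (\<Sum>k<n. (X i *\<^sub>v v) $ k * (X j *\<^sub>v v) $ k)"
      unfolding ij(2) using ij by (simp add: scalar_prod_def lessThan_atLeast0)
    finally show ?thesis .
  qed
  have "v \<bullet> (quad_eval m a n X *\<^sub>v v) =
      (\<Sum>r<n. \<Sum>c<n. v $ r * ((\<Sum>(i, j)\<in>?P. a i j * (X i * X j) $$ (r, c)) * v $ c))"
    unfolding scalar_prod_mult_mat_vec[OF quad_eval_carrier[OF X] v]
    by (simp add: quad_eval_entries[OF X] sum.cartesian_product)
  also have "\<dots> = (\<Sum>r<n. \<Sum>c<n. \<Sum>(i, j)\<in>?P. a i j * (v $ r * ((X i * X j) $$ (r, c) * v $ c)))"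
    by (simp add: sum_distrib_left sum_distrib_right case_prod_unfold mult_ac)
  \<comment> \<open>Instantiating \<open>sum.swap\<close> with \<open>?P\<close> lets it only pull
    the sum over index pairs outwards, so the rewriting does not loop.\<close>
  also have "\<dots> = (\<Sum>(i, j)\<in>?P. a i j * (\<Sum>r<n. \<Sum>c<n. v $ r * ((X i * X j) $$ (r, c) * v $ c)))"
    by (simp add: sum.swap[of _ ?P] sum_distrib_left case_prod_unfold)
  also have "\<dots> = (\<Sum>(i, j)\<in>?P. a i j * (\<Sum>k<n. (X i *\<^sub>v v) $ k * (X j *\<^sub>v v) $ k))"
    by (intro sum.cong) (auto simp: bilinear)
  also have "\<dots> = (\<Sum>k<n. quad_eval_real m a (\<lambda>i. (X i *\<^sub>v v) $ k))"
    by (simp add: eval sum.swap[of _ ?P] sum_distrib_left case_prod_unfold)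
  finally show ?thesis .
qed

section \<open>Semidefiniteness, and its links with real values\<close>

lemma scalar_prod_minus_smult_mat:
  fixes A B :: "real mat"
  assumes "A \<in> carrier_mat n n" "B \<in> carrier_mat n n" "v \<in> carrier_vec n"
  shows "v \<bullet> ((A - l \<cdot>\<^sub>m B) *\<^sub>v v) = v \<bullet> (A *\<^sub>v v) - l * (v \<bullet> (B *\<^sub>v v))"
proof -
  have "(A - l \<cdot>\<^sub>m B) *\<^sub>v v = A *\<^sub>v v - l \<cdot>\<^sub>v (B *\<^sub>v v)"
    using assms by (intro eq_vecI)
      (auto simp: scalar_prod_def sum_distrib_left algebra_simps simp flip: sum_subtractf)
  then show ?thesis
    using assms by (simp add: scalar_prod_minus_distrib[of _ n])
qed

lemma sym_mats_iff_entries: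
  "M \<in> sym_mats n \<longleftrightarrow>
   M \<in> carrier_mat n n \<and> (\<forall>r<n. \<forall>c<n. M $$ (r, c) = M $$ (c, r))"
  unfolding sym_mats_def by (auto simp: mat_eq_iff[of "transpose_mat M"])

lemma minus_smult_sym_mats:
  "A \<in> sym_mats n \<Longrightarrow> B \<in> sym_mats n \<Longrightarrow> A - l \<cdot>\<^sub>m B \<in> sym_mats n"
  unfolding sym_mats_iff_entries by (intro conjI minus_carrier_mat) auto

lemma pos_semidef_iff:
  "M \<in> carrier_mat n n \<Longrightarrow>
   pos_semidef M \<longleftrightarrow> M \<in> sym_mats n \<and> (\<forall>v \<in> carrier_vec n. 0 \<le> v \<bullet> (M *\<^sub>v v))"
  by (auto simp: pos_semidef_def)

lemma pos_semidef_dim_one: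
  "pos_semidef (mat 1 1 (\<lambda>_. c)) \<longleftrightarrow> 0 \<le> c"
proof
  assume "pos_semidef (mat 1 1 (\<lambda>_. c))"
  then have "0 \<le> vec 1 (\<lambda>_. 1) \<bullet> (mat 1 1 (\<lambda>_. c) *\<^sub>v vec 1 (\<lambda>_. 1))"
    unfolding pos_semidef_def by simp
  then show "0 \<le> c" by (simp add: scalar_prod_def)
next
  assume "0 \<le> c"
  then have "0 \<le> x * (c * x)" for x
    using mult_nonneg_nonneg[OF _ zero_le_square, of c x] by (simp add: mult_ac)
  then show "pos_semidef (mat 1 1 (\<lambda>_. c))"
    by (auto simp: pos_semidef_def sym_mats_def scalar_prod_def intro!: eq_matI)
qed

text \<open>Testing with one nonzero vector, available because \<open>0 < n\<close>, gives a
  positive sum of real values of the form; some summand must then be positive.\<close>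

lemma pos_def_quad_eval_real_pos:
  assumes "0 < n" and X: "X \<in> sym_tuples m n" and pd: "pos_def (quad_eval m b n X)"
  obtains x where "0 < quad_eval_real m b x"
proof -
  have "unit_vec n 0 \<noteq> (0\<^sub>v n :: real vec)" using \<open>0 < n\<close> by simp
  then have "0 < unit_vec n 0 \<bullet> (quad_eval m b n X *\<^sub>v unit_vec n 0)"
    using pd carrier_matD(1)[OF quad_eval_carrier[OF X, of b]]
    unfolding pos_def_def by auto
  then have "\<not> (\<Sum>k<n. quad_eval_real m b (\<lambda>i. (X i *\<^sub>v unit_vec n 0) $ k)) \<le> 0"
    by (simp add: quad_eval_scalar_prod[OF X])
  then show thesis using that by (meson not_le sum_nonpos)
qed

theorem theorem1p1:
  fixes m :: nat and a b :: "nat \<Rightarrow> nat \<Rightarrow> real"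
  assumes "0 < m"
    and "\<forall>i<m. \<forall>j<m. a i j = a j i"
    and "\<forall>i<m. \<forall>j<m. b i j = b j i"
    and "\<exists>n>0. \<exists>X \<in> sym_tuples m n. pos_def (quad_eval m b n X)"
  shows
    "((\<forall>x :: nat \<Rightarrow> real. 0 \<le> quad_eval_real m b x \<longrightarrow> 0 \<le> quad_eval_real m a x) \<longleftrightarrow>
      (\<forall>n>0. \<forall>X \<in> sym_tuples m n.
         pos_semidef (quad_eval m b n X) \<longrightarrow> pos_semidef (quad_eval m a n X))) \<and>
     ((\<forall>n>0. \<forall>X \<in> sym_tuples m n.
         pos_semidef (quad_eval m b n X) \<longrightarrow> pos_semidef (quad_eval m a n X)) \<longleftrightarrow>
      (\<exists>l::real. 0 \<le> l \<and> (\<forall>n>0. \<forall>X \<in> sym_tuples m n.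
         pos_semidef (quad_eval m a n X - l \<cdot>\<^sub>m quad_eval m b n X))))"
proof -
  let ?f = "quad_eval_real m a" and ?g = "quad_eval_real m b"
  let ?P1 = "\<forall>x. 0 \<le> ?g x \<longrightarrow> 0 \<le> ?f x"
  let ?P2 = "\<forall>n>0. \<forall>X \<in> sym_tuples m n.
    pos_semidef (quad_eval m b n X) \<longrightarrow> pos_semidef (quad_eval m a n X)"
  let ?P3 = "\<exists>l::real. 0 \<le> l \<and> (\<forall>n>0. \<forall>X \<in> sym_tuples m n.
    pos_semidef (quad_eval m a n X - l \<cdot>\<^sub>m quad_eval m b n X))"
  \<comment> \<open>Real points are tuples of matrices of size 1.\<close>
  have 21: "?P1" if P2: "?P2"
  proof (intro allI impI)
    fix x assume "0 \<le> ?g x"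
    have X: "(\<lambda>i. mat 1 1 (\<lambda>_. x i)) \<in> sym_tuples m 1"
      by (auto simp: sym_tuples_def sym_mats_def intro!: eq_matI)
    have "pos_semidef (quad_eval m b 1 (\<lambda>i. mat 1 1 (\<lambda>_. x i)))"
      using \<open>0 \<le> ?g x\<close> unfolding quad_eval_dim_one pos_semidef_dim_one .
    then have "pos_semidef (quad_eval m a 1 (\<lambda>i. mat 1 1 (\<lambda>_. x i)))"
      by (rule P2[rule_format, OF less_one[THEN iffD2, OF refl] X])
    then show "0 \<le> ?f x" unfolding quad_eval_dim_one pos_semidef_dim_one .
  qed
  have 32: "?P2" if P3: "?P3"
  proof (intro allI impI ballI)
    fix n :: nat and X
    assume "0 < n" and X: "X \<in> sym_tuples m n" and g: "pos_semidef (quad_eval m b n X)"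
    obtain l where "0 \<le> l" and l: "pos_semidef (quad_eval m a n X - l \<cdot>\<^sub>m quad_eval m b n X)"
      using P3 X \<open>0 < n\<close> by blast
    let ?A = "quad_eval m a n X" and ?B = "quad_eval m b n X"
    have car: "?A \<in> carrier_mat n n" "?B \<in> carrier_mat n n" using X by simp_all
    then have car': "?A - l \<cdot>\<^sub>m ?B \<in> carrier_mat n n" by (intro minus_carrier_mat) simp
    have "0 \<le> v \<bullet> (?A *\<^sub>v v)" if v: "v \<in> carrier_vec n" for v
    proof -
      \<comment> \<open>On each vector, \<open>?A\<close> is the sum of the nonnegative
        contributions of \<open>?A - l \<cdot>\<^sub>m ?B\<close> and
        \<open>l \<cdot>\<^sub>m ?B\<close>.\<close>
      have "0 \<le> v \<bullet> (?A *\<^sub>v v) - l * (v \<bullet> (?B *\<^sub>v v))"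
        using l v by (simp add: pos_semidef_iff[OF car'] flip: scalar_prod_minus_smult_mat[OF car v])
      moreover have "0 \<le> l * (v \<bullet> (?B *\<^sub>v v))"
        using g v \<open>0 \<le> l\<close> by (simp add: pos_semidef_iff[OF car(2)])
      ultimately show ?thesis by linarith
    qed
    then show "pos_semidef ?A"
      using quad_eval_sym_mats[OF X assms(2)] by (simp add: pos_semidef_iff[OF car(1)])
  qed
  have 13: "?P3" if P1: "?P1"
  proof -
    obtain x0 where "0 < ?g x0" using assms(4) pos_def_quad_eval_real_pos by metis
    \<comment> \<open>The multiplier is found from real points alone, so it is the same for all
      sizes and all tuples.\<close>
    with P1 obtain l where "0 \<le> l" and l: "\<And>x. l * ?g x \<le> ?f x"
      using homogeneous_S_lemma[of m b a x0] by blast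
    have "pos_semidef (quad_eval m a n X - l \<cdot>\<^sub>m quad_eval m b n X)"
      if X: "X \<in> sym_tuples m n" for n X
    proof -
      let ?A = "quad_eval m a n X" and ?B = "quad_eval m b n X"
      have car: "?A \<in> carrier_mat n n" "?B \<in> carrier_mat n n" using X by simp_all
      then have car': "?A - l \<cdot>\<^sub>m ?B \<in> carrier_mat n n" by (intro minus_carrier_mat) simp
      \<comment> \<open>Both quadratic forms split over the same real points, so the inequality
        \<open>l\<close> is summed coordinate by coordinate.\<close>
      have "0 \<le> v \<bullet> ((?A - l \<cdot>\<^sub>m ?B) *\<^sub>v v)" if v: "v \<in> carrier_vec n" for v
        using l by (simp add: scalar_prod_minus_smult_mat[OF car v] quad_eval_scalar_prod[OF X v]
            sum_distrib_left sum_mono)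
      then show ?thesis
        using minus_smult_sym_mats[OF quad_eval_sym_mats[OF X assms(2)]
            quad_eval_sym_mats[OF X assms(3)]]
        by (simp add: pos_semidef_iff[OF car'])
    qed
    with \<open>0 \<le> l\<close> show ?thesis by blast
  qed
  show ?thesis using 21 32 13 by argo
qed

end
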